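(* Let $\{k_l\}_{l=0}^{\infty}$ be a sequence of positive integers with $k_0=1$, and let $T$ be the infinite rooted tree in which every node at depth $l$ has exactly $k_{l+1}$ descendants in the next generation (children); the root has depth $0$. Let $v$ be a node of $T$ and let $l$ be its depth. Then the asymptotic proportion of the traffic through $v$ is $$ap(v)=\frac{1}{\beta(l)}\left(2-\frac{1}{\beta(l)}-\frac{1}{\beta(l+1)}\right),$$ where $\beta(l):=k_1k_2\cdots k_l$ (with $\beta(0)=1$).
   Context: $T_n$ denotes the finite subtree of $T$ formed by the nodes of generations $0,1,\dots,n$ and $N=N(n)$ its number of nodes. Every pair of distinct nodes of $T_n$ exchanges a unit flow of data along the geodesic path in the tree joining them, so the total traffic is $N(N-1)/2$. For a node $v$ of $T_n$, $l_n(v)$ is the total traffic flow passing through $v$ (the number of unordered pairs of distinct nodes whose connecting path contains $v$, endpoints included), and $p_n(v)=\frac{2\,l_n(v)}{N(N-1)}$ is the proportion of traffic through $v$. The asymptotic proportion of the traffic through $v$ is $ap(v):=\liminf_{n\to\infty}p_n(v)$. *)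

theory Defs
  imports "Graph_Theory.Graph_Theory" "HOL-Library.Extended_Real"
begin

text \<open>
  Undirected graphs are symmetric digraphs, as in \<^theory>\<open>Graph_Theory.Digraph\<close>; the vertex
  set may be infinite. The constant \<^const>\<open>Digraph_Component.tree\<close> only excludes directed
  cycles, so it rejects every symmetric graph with an edge (traversing an edge back and forth is a
  cycle of length 2) and accepts non-trees such as an acyclically oriented triangle. Here a tree
  is a connected simple graph whose only directed cycles are these trivial ones.
\<close>

locale undirected_tree = sym_digraph G + loopfree_digraph G + nomulti_digraph G
  for G :: "('a, 'b) pre_digraph" (structure) +
  assumes connected: "strongly_connected G"
    and acyclic: "cycle p \<Longrightarrow> length p \<le> 2"

definition geodesic :: "('a, 'b) pre_digraph \<Rightarrow> 'a \<Rightarrow> 'b awalk \<Rightarrow> 'a \<Rightarrow> bool" where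
  "geodesic G u p w \<longleftrightarrow>
     pre_digraph.awalk G u p w \<and> (\<forall>q. pre_digraph.awalk G u q w \<longrightarrow> length p \<le> length q)"

definition depth :: "('a, 'b) pre_digraph \<Rightarrow> 'a \<Rightarrow> 'a \<Rightarrow> nat" where
  "depth G r v = (LEAST m. \<exists>p. pre_digraph.awalk G r p v \<and> length p = m)"

definition children :: "('a, 'b) pre_digraph \<Rightarrow> 'a \<Rightarrow> 'a \<Rightarrow> 'a set" where
  "children G r u = {w \<in> verts G. u \<rightarrow>\<^bsub>G\<^esub> w \<and> depth G r w = depth G r u + 1}"

definition truncation :: "('a, 'b) pre_digraph \<Rightarrow> 'a \<Rightarrow> nat \<Rightarrow> ('a, 'b) pre_digraph" where
  "truncation G r n = G \<restriction> {v \<in> verts G. depth G r v \<le> n}"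

definition traffic :: "('a, 'b) pre_digraph \<Rightarrow> 'a \<Rightarrow> nat" where
  "traffic G v = card {{a, b} | a b. a \<in> verts G \<and> b \<in> verts G \<and> a \<noteq> b \<and>
     (\<exists>p. geodesic G a p b \<and> v \<in> set (pre_digraph.awalk_verts G a p))}"

definition traffic_proportion :: "('a, 'b) pre_digraph \<Rightarrow> 'a \<Rightarrow> real" where
  "traffic_proportion G v =
     2 * real (traffic G v) / (real (card (verts G)) * (real (card (verts G)) - 1))"

definition ap :: "('a, 'b) pre_digraph \<Rightarrow> 'a \<Rightarrow> 'a \<Rightarrow> ereal" where
  "ap G r v = liminf (\<lambda>n. ereal (traffic_proportion (truncation G r n) v))"

definition \<beta> :: "(nat \<Rightarrow> nat) \<Rightarrow> nat \<Rightarrow> real" where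
  "\<beta> k l = (\<Prod>i=1..l. real (k i))"

end

theory Submission
  imports Defs
begin

text \<open>
  Removing a node \<open>v\<close> from a finite tree splits the rest into branches: one below each child of
  \<open>v\<close>, and the set of all nodes that are not descendants of \<open>v\<close>. A pair of nodes sends its traffic
  through \<open>v\<close> exactly when the two nodes do not lie in the same branch, so the traffic that avoids
  \<open>v\<close> is counted by \<open>m choose 2\<close>, summed over the branch sizes \<open>m\<close>
  (\<open>traffic_cut_vertex\<close>, \<open>traffic_truncation\<close>).

  Each branch is attached to \<open>v\<close> at a single node, its gate. A walk that leaves the branch and comes
  back visits the gate twice, hence is no geodesic (\<open>geodesic_stays_behind_gate\<close>); a walk from one
  branch to another leaves the first one through \<open>v\<close>.
  The absence of cycles enters only through \<open>lower_neighbour_unique\<close>: a node has at most one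
  neighbour that is not deeper than itself. Consequently every arc joins a parent and its child, and
  parents are unique.

  By unique parenthood the descendants of a node of depth \<open>l\<close> that have depth \<open>j\<close> number
  \<open>\<beta> j / \<beta> l\<close>, so up to depth \<open>n\<close> there are \<open>(\<beta> l + \<dots> + \<beta> n) / \<beta> l\<close> of them.
  The whole truncation has \<open>N = \<beta> 0 + \<dots> + \<beta> n\<close> nodes, and \<open>N\<close> tends to infinity because
  \<open>\<beta> \<ge> 1\<close>, even if the tree is a single ray. Thus the descendants of a node of depth \<open>l\<close> make up a
  proportion tending to \<open>1 / \<beta> l\<close> (\<open>descendants_fraction\<close>), and a set of asymptotic proportion \<open>q\<close>
  contains a proportion \<open>q\<^sup>2\<close> of all pairs (\<open>tendsto_pair_fraction\<close>). The limit is therefore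
  \<open>1 - (1 - 1 / \<beta> l)\<^sup>2 - k (l + 1) / (\<beta> (l + 1))\<^sup>2\<close>, which is the claimed value since
  \<open>\<beta> (l + 1) = \<beta> l * k (l + 1)\<close>.
\<close>

section \<open>Geodesics through a cut vertex\<close>

lemma (in wf_digraph) awalk_crossing_arc:
  assumes "awalk a p b" "a \<in> S" "b \<notin> S"
  obtains e where "e \<in> set p" "tail G e \<in> S" "head G e \<notin> S"
proof -
  have "\<exists>e\<in>set p. tail G e \<in> S \<and> head G e \<notin> S"
    using assms
  proof (induct p arbitrary: a)
    case (Cons e es)
    then show ?case by (cases "head G e \<in> S") (auto simp: awalk_Cons_iff)
  qed (simp add: awalk_Nil_iff)
  then show thesis using that by blast
qed

lemma (in wf_digraph) geodesic_exists:
  assumes "a \<rightarrow>\<^sup>* b"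
  obtains p where "geodesic G a p b"
proof -
  obtain p where "awalk a p b" using assms by (auto simp: reachable_awalk)
  then obtain q where "awalk a q b" "\<And>q'. awalk a q' b \<Longrightarrow> length q \<le> length q'"
    using ex_has_least_nat[of "\<lambda>p. awalk a p b" p length] by blast
  then show thesis using that by (auto simp: geodesic_def)
qed

text \<open>
  A walk that left \<open>S\<close> would do so from the gate \<open>g\<close> and, arcs being symmetric, would also return
  to \<open>g\<close>; cutting out the detour makes it strictly shorter.
\<close>
lemma (in sym_digraph) geodesic_stays_behind_gate:
  assumes gate: "\<And>x y. \<lbrakk>x \<in> S; y \<notin> S; x \<rightarrow>\<^bsub>G\<^esub> y\<rbrakk> \<Longrightarrow> x = g"
    and geo: "geodesic G a p b" and "a \<in> S" "b \<in> S"
  shows "set (awalk_verts a p) \<subseteq> S"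
proof
  fix v assume "v \<in> set (awalk_verts a p)"
  show "v \<in> S"
  proof (rule ccontr)
    assume "v \<notin> S"
    have walk: "awalk a p b" using geo by (simp add: geodesic_def)
    then obtain q s where p: "p = q @ s" and q: "awalk a q v" and s: "awalk v s b"
      using awalk_decomp \<open>v \<in> set (awalk_verts a p)\<close> by blast
    obtain e where e: "e \<in> set q" "tail G e \<in> S" "head G e \<notin> S"
      using awalk_crossing_arc[OF q \<open>a \<in> S\<close> \<open>v \<notin> S\<close>] .
    obtain f where f: "f \<in> set s" "tail G f \<notin> S" "head G f \<in> S"
      using awalk_crossing_arc[OF s, of "- S"] \<open>v \<notin> S\<close> \<open>b \<in> S\<close> by auto
    have "tail G e \<rightarrow>\<^bsub>G\<^esub> head G e" "tail G f \<rightarrow>\<^bsub>G\<^esub> head G f"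
      using e f q s by (auto intro!: in_arcs_imp_in_arcs_ends simp: awalk_def)
    then have g: "tail G e = g" "head G f = g"
      using gate e f graph_symmetric by blast+
    have "g \<in> set (awalk_verts a q)" using awalk_verts_arc1[OF e(1)] g by metis
    then obtain q1 q2 where q12: "q = q1 @ q2" "awalk a q1 g" "awalk g q2 v"
      using awalk_decomp[OF q] by blast
    have "g \<in> set (awalk_verts v s)" using awalk_verts_arc2[OF s f(1)] g by metis
    then obtain s1 s2 where s12: "s = s1 @ s2" "awalk g s2 b"
      using awalk_decomp[OF s] by blast
    have "q2 \<noteq> []" using q12(3) g(1) e(2) \<open>v \<notin> S\<close> by (auto simp: awalk_Nil_iff)
    moreover have "length p \<le> length (q1 @ s2)"
      using geo awalk_appendI[OF q12(2) s12(2)] unfolding geodesic_def by blast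
    ultimately show False using p q12(1) s12(1) by simp
  qed
qed

lemma pairs_eq_subsets:
  "{{a, b} | a b. a \<in> A \<and> b \<in> A \<and> a \<noteq> b} = {X. X \<subseteq> A \<and> card X = 2}"
  by (auto simp: card_2_iff)

text \<open>
  The sets \<open>B i\<close> are the components left after the removal of \<open>v\<close>, each attached to \<open>v\<close> at its gate
  \<open>g i\<close>. They form an indexed family and not a set of sets because in a truncation several of them
  can be empty at once.
\<close>
lemma (in sym_digraph) traffic_cut_vertex:
  assumes fin: "finite (verts G)" and conn: "strongly_connected G" and "finite I"
    and part: "verts G - {v} = (\<Union>i\<in>I. B i)"
    and disj: "disjoint_family_on B I"
    and v: "v \<in> verts G"
    and gate: "\<And>i x y. \<lbrakk>i \<in> I; x \<in> B i; y \<notin> B i; x \<rightarrow>\<^bsub>G\<^esub> y\<rbrakk> \<Longrightarrow> x = g i \<and> y = v"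
  shows "traffic G v + (\<Sum>i\<in>I. card (B i) choose 2) = card (verts G) choose 2"
proof -
  define R where "R a b \<longleftrightarrow> (\<exists>p. geodesic G a p b \<and> v \<in> set (awalk_verts a p))" for a b
  have sep: "R a b \<longleftrightarrow> \<not> (\<exists>i\<in>I. a \<in> B i \<and> b \<in> B i)"
    if ab: "a \<in> verts G" "b \<in> verts G" for a b
  proof
    assume "R a b"
    then obtain p where p: "geodesic G a p b" "v \<in> set (awalk_verts a p)"
      by (auto simp: R_def)
    show "\<not> (\<exists>i\<in>I. a \<in> B i \<and> b \<in> B i)"
    proof
      assume "\<exists>i\<in>I. a \<in> B i \<and> b \<in> B i"
      then obtain i where i: "i \<in> I" "a \<in> B i" "b \<in> B i" by blast
      then have "set (awalk_verts a p) \<subseteq> B i"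
        using geodesic_stays_behind_gate[of "B i" "g i"] gate p by blast
      then show False using p(2) i(1) part by blast
    qed
  next
    assume no: "\<not> (\<exists>i\<in>I. a \<in> B i \<and> b \<in> B i)"
    have "a \<rightarrow>\<^sup>* b" using conn ab by (auto simp: strongly_connected_def)
    then obtain p where p: "geodesic G a p b" by (rule geodesic_exists)
    then have walk: "awalk a p b" by (simp add: geodesic_def)
    have "v \<in> set (awalk_verts a p)"
    proof (cases "a = v")
      case True
      then show ?thesis using hd_in_awalk_verts(1)[OF walk] by simp
    next
      case False
      then obtain i where i: "i \<in> I" "a \<in> B i" using part ab by blast
      obtain e where e: "e \<in> set p" "tail G e \<in> B i" "head G e \<notin> B i"
        using awalk_crossing_arc[OF walk i(2)] no i by blast
      moreover have "tail G e \<rightarrow>\<^bsub>G\<^esub> head G e"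
        using e(1) walk by (auto intro!: in_arcs_imp_in_arcs_ends simp: awalk_def)
      ultimately have "head G e = v" using gate[OF i(1)] by blast
      then show ?thesis using awalk_verts_arc2[OF walk e(1)] by simp
    qed
    then show "R a b" using p by (auto simp: R_def)
  qed
  define P where "P A = {{a, b} | a b. a \<in> A \<and> b \<in> A \<and> a \<noteq> b}" for A :: "'a set"
  define Q where "Q = {{a, b} | a b. a \<in> verts G \<and> b \<in> verts G \<and> a \<noteq> b \<and> R a b}"
  have sub: "B i \<subseteq> verts G" if "i \<in> I" for i using part that by blast
  have finB: "finite (B i)" if "i \<in> I" for i using sub[OF that] fin by (rule finite_subset)
  have finP: "finite (P A)" if "finite A" for A
    unfolding P_def pairs_eq_subsets using that by simp
  have cardP: "card (P A) = card A choose 2" if "finite A" for A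
    unfolding P_def pairs_eq_subsets using n_subsets[OF that] by simp
  have "P (verts G) = Q \<union> (\<Union>i\<in>I. P (B i))"
  proof
    show "P (verts G) \<subseteq> Q \<union> (\<Union>i\<in>I. P (B i))"
    proof
      fix X assume "X \<in> P (verts G)"
      then obtain a b where ab: "X = {a, b}" "a \<in> verts G" "b \<in> verts G" "a \<noteq> b"
        unfolding P_def by blast
      show "X \<in> Q \<union> (\<Union>i\<in>I. P (B i))"
      proof (cases "R a b")
        case True
        then have "X \<in> Q" using ab unfolding Q_def by blast
        then show ?thesis by blast
      next
        case False
        then obtain i where i: "i \<in> I" "a \<in> B i" "b \<in> B i" using sep ab(2,3) by blast
        then have "X \<in> P (B i)" using ab unfolding P_def by blast
        then show ?thesis using i(1) by blast
      qed
    qed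
    have "Q \<subseteq> P (verts G)" unfolding P_def Q_def by blast
    moreover have "P (B i) \<subseteq> P (verts G)" if "i \<in> I" for i
      using sub[OF that] unfolding P_def by blast
    ultimately show "Q \<union> (\<Union>i\<in>I. P (B i)) \<subseteq> P (verts G)" by blast
  qed
  moreover have "Q \<inter> (\<Union>i\<in>I. P (B i)) = {}"
  proof -
    have False if X: "X \<in> Q" "X \<in> P (B i)" and "i \<in> I" for X i
    proof -
      obtain a b where ab: "X = {a, b}" "a \<in> verts G" "b \<in> verts G" "R a b"
        using X(1) unfolding Q_def by blast
      have "a \<in> B i \<and> b \<in> B i" using X(2) ab(1) unfolding P_def by (auto simp: doubleton_eq_iff)
      then show False using sep ab \<open>i \<in> I\<close> by blast
    qed
    then show ?thesis by blast
  qed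
  moreover have "finite Q"
    by (rule finite_subset[OF _ finP[OF fin]]) (auto simp: Q_def P_def)
  moreover have "finite (\<Union>i\<in>I. P (B i))" using \<open>finite I\<close> finP finB by blast
  ultimately have "card (P (verts G)) = card Q + card (\<Union>i\<in>I. P (B i))"
    by (simp add: card_Un_disjoint)
  also have "card (\<Union>i\<in>I. P (B i)) = (\<Sum>i\<in>I. card (P (B i)))"
  proof (rule card_UN_disjoint[OF \<open>finite I\<close>])
    show "\<forall>i\<in>I. finite (P (B i))" using finP finB by blast
    show "\<forall>i\<in>I. \<forall>j\<in>I. i \<noteq> j \<longrightarrow> P (B i) \<inter> P (B j) = {}"
    proof (intro ballI impI)
      fix i j assume "i \<in> I" "j \<in> I" "i \<noteq> j"
      then have "B i \<inter> B j = {}" using disj by (auto simp: disjoint_family_on_def)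
      then show "P (B i) \<inter> P (B j) = {}"
        unfolding P_def by (auto simp: doubleton_eq_iff)
    qed
  qed
  also have "\<dots> = (\<Sum>i\<in>I. card (B i) choose 2)"
    by (rule sum.cong) (auto simp: cardP finB)
  also have "card Q = traffic G v" by (simp add: Q_def R_def traffic_def)
  finally show ?thesis using cardP[OF fin] by simp
qed

section \<open>Rooted trees\<close>

locale rooted_undirected_tree = undirected_tree +
  fixes r
  assumes root: "r \<in> verts G"
begin

abbreviation d :: "'a \<Rightarrow> nat" where "d \<equiv> depth G r"

lemma depth_le: "awalk r p x \<Longrightarrow> d x \<le> length p"
  unfolding depth_def by (rule Least_le) blast

lemma depth_walk:
  assumes "x \<in> verts G"
  obtains p where "awalk r p x" "length p = d x"
proof -
  have "r \<rightarrow>\<^sup>* x" using connected root assms by (auto simp: strongly_connected_def)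
  then have "\<exists>m p. awalk r p x \<and> length p = m" by (auto simp: reachable_awalk)
  then have "\<exists>p. awalk r p x \<and> length p = d x" unfolding depth_def by (rule LeastI_ex)
  then show thesis using that by blast
qed

lemma depth_root: "d r = 0"
  using depth_le[of "[]" r] root by (simp add: awalk_Nil_iff)

lemma depth_arc_le:
  assumes "x \<rightarrow>\<^bsub>G\<^esub> y" shows "d y \<le> Suc (d x)"
proof -
  obtain e where e: "e \<in> arcs G" "tail G e = x" "head G e = y" using assms by (rule reachableE)
  obtain p where p: "awalk r p x" "length p = d x" using depth_walk e by (metis tail_in_verts)
  have "awalk x [e] y" using arc_implies_awalk[OF e(1)] e by simp
  then have "d y \<le> length (p @ [e])" using awalk_appendI p(1) by (intro depth_le) blast
  then show ?thesis using p(2) by simp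
qed

lemma lower_neighbour_exists:
  assumes "x \<in> verts G" "x \<noteq> r"
  obtains y where "y \<rightarrow>\<^bsub>G\<^esub> x" "d x = Suc (d y)"
proof -
  obtain p where p: "awalk r p x" "length p = d x" using depth_walk assms(1) .
  have "p \<noteq> []" using p(1) assms(2) by (auto simp: awalk_Nil_iff)
  then obtain q e where qe: "p = q @ [e]" by (metis rev_exhaust)
  then have e: "awalk r q (tail G e)" "e \<in> arcs G" "head G e = x"
    using p(1) by (auto simp: awalk_simps)
  then have adj: "tail G e \<rightarrow>\<^bsub>G\<^esub> x" using in_arcs_imp_in_arcs_ends by blast
  then have "d x = Suc (d (tail G e))"
    using depth_arc_le[OF adj] depth_le[OF e(1)] p(2) qe by simp
  then show thesis using that adj by blast
qed

text \<open>
  Following lower neighbours from \<open>x\<close> to the root only meets nodes above \<open>x\<close>. This provides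
  connections inside induced subgraphs, both for truncations and for finding cycles.
\<close>
lemma reachable_from_root_downwards:
  assumes "x \<in> S" "{z \<in> verts G. d z < d x} \<subseteq> S" "S \<subseteq> verts G"
  shows "r \<rightarrow>\<^sup>*\<^bsub>G \<restriction> S\<^esub> x"
  using assms
proof (induct "d x" arbitrary: x rule: less_induct)
  case less
  interpret S: wf_digraph "G \<restriction> S" ..
  show ?case
  proof (cases "x = r")
    case True
    then show ?thesis using less.prems by simp
  next
    case False
    then obtain y where y: "y \<rightarrow>\<^bsub>G\<^esub> x" "d x = Suc (d y)"
      using lower_neighbour_exists less.prems by blast
    then have yS: "y \<in> S" using less.prems adj_in_verts by auto
    have "r \<rightarrow>\<^sup>*\<^bsub>G \<restriction> S\<^esub> y"
      using y less.prems by (intro less.hyps) (auto simp: yS)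
    moreover have "y \<rightarrow>\<^bsub>G \<restriction> S\<^esub> x" using y(1) yS less.prems(1) by (auto simp: arcs_ends_conv image_iff)
    ultimately show ?thesis by (rule S.reachable_adj_trans)
  qed
qed

text \<open>
  From two such neighbours \<open>x\<close> and \<open>y\<close> one can walk up to the root without meeting \<open>w\<close>, as \<open>w\<close> is at
  least as deep. This gives a path from \<open>x\<close> to \<open>y\<close> that avoids \<open>w\<close>, and \<open>w\<close> closes it to a cycle of
  length at least three. Equal depth is included in order to exclude arcs within a
  generation as well.
\<close>
lemma lower_neighbour_unique:
  assumes "x \<rightarrow>\<^bsub>G\<^esub> w" "y \<rightarrow>\<^bsub>G\<^esub> w" "d x \<le> d w" "d y \<le> d w"
  shows "x = y"
proof (rule ccontr)
  assume "x \<noteq> y"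
  define S where "S = verts G - {w}"
  have "x \<noteq> w" "y \<noteq> w" using assms adj_not_same by blast+
  have "symmetric (G \<restriction> S)"
    by (rule induced_graph_imp_symmetric[OF sym_arcs]) (auto simp: S_def)
  interpret S: wf_digraph "G \<restriction> S" ..
  have sub: "subgraph (G \<restriction> S) G" by (rule subgraph_induce_subgraphI) (auto simp: S_def)
  have "r \<rightarrow>\<^sup>*\<^bsub>G \<restriction> S\<^esub> x" "r \<rightarrow>\<^sup>*\<^bsub>G \<restriction> S\<^esub> y"
    using assms adj_in_verts \<open>x \<noteq> w\<close> \<open>y \<noteq> w\<close>
    by (auto intro!: reachable_from_root_downwards simp: S_def)
  then have "x \<rightarrow>\<^sup>*\<^bsub>G \<restriction> S\<^esub> y"
    using symmetric_reachable[OF \<open>symmetric (G \<restriction> S)\<close>] S.reachable_trans by blast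
  then obtain p where p: "S.apath x p y" by (auto simp: S.reachable_apath)
  then have "set (S.awalk_verts x p) \<subseteq> S" using S.awalkE'[OF S.awalkI_apath[OF p]] by simp
  then have "w \<notin> set (S.awalk_verts x p)" by (auto simp: S_def)
  then have w: "w \<notin> set (awalk_verts x p)" by (simp add: awalk_verts_induce)
  have ap: "apath x p y" using subgraph_apath_imp_apath[OF p sub] .
  obtain e where e: "e \<in> arcs G" "tail G e = w" "head G e = x"
    using assms(1) graph_symmetric reachableE by metis
  obtain f where f: "f \<in> arcs G" "tail G f = y" "head G f = w"
    using assms(2) reachableE by metis
  have walk: "awalk x (p @ [f]) w"
    using ap f by (auto simp: apath_def awalk_simps)
  have "awalk_verts x (p @ [f]) = awalk_verts x p @ [w]"
    using awalk_verts_append[OF walk] f by simp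
  then have "distinct (awalk_verts x (p @ [f]))" using ap w by (simp add: apath_def)
  then have "cycle (e # p @ [f])"
    unfolding cycle_def using walk e by (intro exI[of _ w]) (simp add: awalk_Cons_iff del: awalk_append_iff)
  then have "length (e # p @ [f]) \<le> 2" by (rule acyclic)
  then have "p = []" by simp
  then show False using ap \<open>x \<noteq> y\<close> by (simp add: apath_Nil_iff)
qed

definition child_rel :: "('a \<times> 'a) set" where
  "child_rel = {(u, w). w \<in> children G r u}"

lemma child_rel_iff: "(u, w) \<in> child_rel \<longleftrightarrow> u \<rightarrow>\<^bsub>G\<^esub> w \<and> d w = Suc (d u)"
  by (auto simp: child_rel_def children_def dest: adj_in_verts(2))

lemma arc_is_child:
  assumes "x \<rightarrow>\<^bsub>G\<^esub> y" shows "(x, y) \<in> child_rel \<or> (y, x) \<in> child_rel"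
proof -
  have sym: "y \<rightarrow>\<^bsub>G\<^esub> x" using graph_symmetric assms .
  have "d x \<noteq> d y"
  proof
    assume eq: "d x = d y"
    (* If x is not the root, its lower neighbour z and y are both neighbours of x that are not
       deeper than x, hence equal, although their depths differ. *)
    show False
    proof (cases "x = r")
      case True
      then obtain p where "awalk r p y" "length p = 0"
        using depth_walk adj_in_verts(2)[OF assms] eq depth_root by metis
      then have "x = y" using True by (simp add: awalk_Nil_iff)
      then show False using assms adj_not_same by blast
    next
      case False
      then obtain z where z: "z \<rightarrow>\<^bsub>G\<^esub> x" "d x = Suc (d z)"
        using lower_neighbour_exists adj_in_verts(1)[OF assms] by blast
      have "d z \<le> d x" "d y \<le> d x" using z(2) eq by linarith+
      then have "z = y" using lower_neighbour_unique[OF z(1) sym] by blast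
      then show False using z(2) eq by (metis n_not_Suc_n)
    qed
  qed
  then have "d y = Suc (d x) \<or> d x = Suc (d y)"
    using depth_arc_le[OF assms] depth_arc_le[OF sym] by linarith
  then show ?thesis using assms sym unfolding child_rel_iff by blast
qed

lemma parent_unique: "single_valued (child_rel\<inverse>)"
proof (rule single_valuedI)
  fix x y z assume "(x, y) \<in> child_rel\<inverse>" "(x, z) \<in> child_rel\<inverse>"
  then have "y \<rightarrow>\<^bsub>G\<^esub> x" "z \<rightarrow>\<^bsub>G\<^esub> x" "d y \<le> d x" "d z \<le> d x"
    by (auto simp: child_rel_iff)
  then show "y = z" by (rule lower_neighbour_unique)
qed

definition descendants :: "'a \<Rightarrow> 'a set" where
  "descendants v = child_rel\<^sup>* `` {v}"

lemma descendants_refl: "v \<in> descendants v"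
  by (simp add: descendants_def)

lemma descendants_child: "x \<in> descendants v \<Longrightarrow> (x, y) \<in> child_rel \<Longrightarrow> y \<in> descendants v"
  unfolding descendants_def by (auto intro: rtrancl_into_rtrancl)

lemma descendants_parent:
  assumes "y \<in> descendants v" "y \<noteq> v" "(x, y) \<in> child_rel"
  shows "x \<in> descendants v"
proof -
  obtain z where z: "(v, z) \<in> child_rel\<^sup>*" "(z, y) \<in> child_rel"
    using assms(1,2) by (auto simp: descendants_def elim: rtranclE)
  then have "z = x" using parent_unique assms(3) by (auto simp: single_valued_def)
  then show ?thesis using z by (simp add: descendants_def)
qed

lemma relpow_child_rel_depth:
  "(v, x) \<in> child_rel ^^ m \<Longrightarrow> d x = d v + m"
proof (induct m arbitrary: x)
  case (Suc m)
  then show ?case by (auto simp: child_rel_iff)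
qed simp

lemma depth_descendants: "x \<in> descendants v \<Longrightarrow> d v \<le> d x"
  by (auto simp: descendants_def rtrancl_power dest: relpow_child_rel_depth)

lemma descendants_in_verts: "v \<in> verts G \<Longrightarrow> x \<in> descendants v \<Longrightarrow> x \<in> verts G"
  unfolding descendants_def by (auto elim!: rtranclE simp: child_rel_def children_def)

lemma descendants_root: "descendants r = verts G"
proof
  show "descendants r \<subseteq> verts G" using descendants_in_verts[OF root] by blast
  have "x \<in> descendants r" if "x \<in> verts G" for x
    using that
  proof (induct "d x" arbitrary: x rule: less_induct)
    case less
    show ?case
    proof (cases "x = r")
      case False
      then obtain y where "y \<rightarrow>\<^bsub>G\<^esub> x" "d x = Suc (d y)"
        using lower_neighbour_exists less.prems by blast
      then show ?thesis
        using less.hyps[of y] descendants_child[of y] adj_in_verts by (auto simp: child_rel_iff)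
    qed (simp add: descendants_refl)
  qed
  then show "verts G \<subseteq> descendants r" by blast
qed

lemma disjoint_relpow_images:
  assumes "x \<noteq> y"
  shows "(child_rel ^^ m) `` {x} \<inter> (child_rel ^^ m) `` {y} = {}"
proof -
  have "x = y" if "(x, z) \<in> child_rel ^^ m" "(y, z) \<in> child_rel ^^ m" for z
    using that
  proof (induct m arbitrary: z)
    case (Suc m)
    then show ?case using parent_unique by (auto simp: single_valued_def)
  qed simp
  then show ?thesis using assms by blast
qed

lemma disjoint_descendants:
  assumes "x \<noteq> y" "d x = d y"
  shows "descendants x \<inter> descendants y = {}"
proof -
  have False if "z \<in> descendants x" "z \<in> descendants y" for z
  proof -
    obtain m n where mn: "(x, z) \<in> child_rel ^^ m" "(y, z) \<in> child_rel ^^ n"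
      using \<open>z \<in> descendants x\<close> \<open>z \<in> descendants y\<close> by (auto simp: descendants_def rtrancl_power)
    then have "m = n" using relpow_child_rel_depth[OF mn(1)] relpow_child_rel_depth[OF mn(2)] assms(2) by simp
    then show False using mn disjoint_relpow_images[OF assms(1), of m] by blast
  qed
  then show ?thesis by blast
qed

lemma descendants_unfold:
  "descendants v = insert v (\<Union>c\<in>children G r v. descendants c)"
proof -
  have "(v, x) \<in> child_rel\<^sup>* \<longleftrightarrow> x = v \<or> (\<exists>c\<in>children G r v. (c, x) \<in> child_rel\<^sup>*)" for x
  proof
    assume "(v, x) \<in> child_rel\<^sup>*"
    then show "x = v \<or> (\<exists>c\<in>children G r v. (c, x) \<in> child_rel\<^sup>*)"
      by (cases rule: converse_rtranclE) (auto simp: child_rel_def)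
  next
    assume "x = v \<or> (\<exists>c\<in>children G r v. (c, x) \<in> child_rel\<^sup>*)"
    then show "(v, x) \<in> child_rel\<^sup>*"
      by (auto simp: child_rel_def intro: converse_rtrancl_into_rtrancl)
  qed
  then show ?thesis by (auto simp: descendants_def)
qed

text \<open>
  The only way out of the descendants of \<open>v\<close> leads from \<open>v\<close> to its parent. Applied to \<open>v\<close> and to its
  children, this yields the gates of all branches at \<open>v\<close>.
\<close>
lemma arc_out_of_descendants:
  assumes "x \<in> descendants v" "y \<notin> descendants v" "x \<rightarrow>\<^bsub>G\<^esub> y"
  shows "x = v \<and> (y, v) \<in> child_rel"
proof -
  have "(y, x) \<in> child_rel" using arc_is_child[OF assms(3)] descendants_child assms by blast
  then show ?thesis using descendants_parent assms by blast
qed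

section \<open>Traffic in a truncated tree\<close>

abbreviation level_set :: "nat \<Rightarrow> 'a set" where
  "level_set n \<equiv> {x \<in> verts G. d x \<le> n}"

lemma verts_truncation: "verts (truncation G r n) = level_set n"
  by (simp add: truncation_def)

lemma sym_digraph_truncation: "sym_digraph (truncation G r n)"
  unfolding truncation_def by (rule induced_graph_imp_graph) auto

lemma strongly_connected_truncation: "strongly_connected (truncation G r n)"
proof -
  interpret H: sym_digraph "truncation G r n" by (rule sym_digraph_truncation)
  have "r \<rightarrow>\<^sup>*\<^bsub>truncation G r n\<^esub> x" if "x \<in> level_set n" for x
    unfolding truncation_def using that by (intro reachable_from_root_downwards) auto
  then have "x \<rightarrow>\<^sup>*\<^bsub>truncation G r n\<^esub> y" if "x \<in> level_set n" "y \<in> level_set n" for x y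
    using that H.symmetric_reachable' H.reachable_trans by blast
  moreover have "r \<in> level_set n" using root depth_root by simp
  ultimately show ?thesis
    unfolding strongly_connected_def verts_truncation by blast
qed

text \<open>
  The instance of the cut vertex count for the branches at \<open>v\<close>: one below each child \<open>c\<close>, with
  gate \<open>c\<close>, and the outer one, with the parent of \<open>v\<close> as its gate.
\<close>
lemma traffic_truncation:
  assumes fin: "finite (level_set n)" and finC: "finite (children G r v)"
    and v: "v \<in> level_set n"
  shows "traffic (truncation G r n) v + (card (level_set n - descendants v) choose 2)
      + (\<Sum>c\<in>children G r v. card (level_set n \<inter> descendants c) choose 2)
    = card (level_set n) choose 2"
proof -
  interpret H: sym_digraph "truncation G r n" by (rule sym_digraph_truncation)
  (* None stands for the outer branch. For v = r it is empty, and the description in g denotes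
     nothing in particular. *)
  define I where "I = insert None (Some ` children G r v)"
  define B where "B i = (case i of None \<Rightarrow> level_set n - descendants v
    | Some c \<Rightarrow> level_set n \<inter> descendants c)" for i
  define g where "g i = (case i of None \<Rightarrow> (THE y. (y, v) \<in> child_rel) | Some c \<Rightarrow> c)" for i
  have child: "(v, c) \<in> child_rel" if "c \<in> children G r v" for c
    using that by (simp add: child_rel_def)
  have up: "v \<notin> descendants c" if "c \<in> children G r v" for c
    using depth_descendants[of v c] child[OF that] by (auto simp: child_rel_iff)
  have "traffic (truncation G r n) v + (\<Sum>i\<in>I. card (B i) choose 2)
      = card (verts (truncation G r n)) choose 2"
  proof (rule H.traffic_cut_vertex[where g = g])
    show "finite (verts (truncation G r n))" using fin by (simp add: verts_truncation)
    show "strongly_connected (truncation G r n)" by (rule strongly_connected_truncation)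
    show "finite I" using finC by (simp add: I_def)
    show "v \<in> verts (truncation G r n)" using v by (simp add: verts_truncation)
    show "verts (truncation G r n) - {v} = (\<Union>i\<in>I. B i)"
      using descendants_unfold[of v] up by (auto simp: I_def B_def verts_truncation)
    show "disjoint_family_on B I"
      unfolding disjoint_family_on_def
    proof (intro ballI impI)
      fix i j assume ij: "i \<in> I" "j \<in> I" "i \<noteq> j"
      have siblings: "descendants c \<inter> descendants c' = {}"
        if "c \<in> children G r v" "c' \<in> children G r v" "c \<noteq> c'" for c c'
        using that child by (intro disjoint_descendants) (auto simp: child_rel_iff)
      have below: "descendants c \<subseteq> descendants v" if "c \<in> children G r v" for c
        using descendants_unfold[of v] that by blast
      consider c where "c \<in> children G r v" "i = None" "j = Some c"
        | c where "c \<in> children G r v" "j = None" "i = Some c"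
        | c c' where "c \<in> children G r v" "c' \<in> children G r v" "i = Some c" "j = Some c'"
        using ij by (auto simp: I_def)
      then show "B i \<inter> B j = {}"
      proof cases
        case 1
        then show ?thesis using below[of c] by (auto simp: B_def)
      next
        case 2
        then show ?thesis using below[of c] by (auto simp: B_def)
      next
        case (3 c c')
        then show ?thesis using siblings[of c c'] ij(3) by (auto simp: B_def)
      qed
    qed
    fix i x y
    assume i: "i \<in> I" and x: "x \<in> B i" and y: "y \<notin> B i" and arc: "x \<rightarrow>\<^bsub>truncation G r n\<^esub> y"
    have arcG: "x \<rightarrow>\<^bsub>G\<^esub> y" using arc unfolding truncation_def by (rule dominates_induce_subgraphD)
    have yn: "y \<in> level_set n" using H.adj_in_verts(2)[OF arc] by (simp add: verts_truncation)
    show "x = g i \<and> y = v"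
    proof (cases i)
      case None
      then have "y \<in> descendants v" "x \<notin> descendants v" using x y yn by (auto simp: B_def)
      then have "y = v" "(x, v) \<in> child_rel"
        using arc_out_of_descendants graph_symmetric[OF arcG] by blast+
      moreover have "(THE y. (y, v) \<in> child_rel) = x"
        using \<open>(x, v) \<in> child_rel\<close> parent_unique by (auto simp: single_valued_def)
      ultimately show ?thesis using None by (simp add: g_def)
    next
      case (Some c)
      then have c: "c \<in> children G r v" using i by (auto simp: I_def)
      have "x \<in> descendants c" "y \<notin> descendants c" using x y yn Some by (auto simp: B_def)
      then have "x = c" "(y, c) \<in> child_rel" using arc_out_of_descendants arcG by blast+
      then show ?thesis using child[OF c] parent_unique Some
        by (auto simp: single_valued_def g_def)
    qed
  qed
  then show ?thesis
    using finC by (simp add: I_def B_def verts_truncation sum.reindex)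
qed

end

section \<open>Growth of the truncations\<close>

locale level_regular_tree = rooted_undirected_tree +
  fixes k :: "nat \<Rightarrow> nat"
  assumes k_pos: "k i > 0"
    and card_children: "u \<in> verts G \<Longrightarrow> card (children G r u) = k (d u + 1)"
begin

lemma finite_children: "u \<in> verts G \<Longrightarrow> finite (children G r u)"
  using card_children k_pos by (metis card.infinite less_irrefl)

lemma beta_pos: "\<beta> k m > 0"
  unfolding \<beta>_def using k_pos by (simp add: prod_pos)

lemma beta_Suc: "\<beta> k (Suc m) = \<beta> k m * real (k (Suc m))"
  by (simp add: \<beta>_def)

lemma beta_ge_1: "\<beta> k m \<ge> 1"
proof (induct m)
  case (Suc m)
  have "real (k (Suc m)) \<ge> 1" using k_pos[of "Suc m"] by simp
  then show ?case using mult_mono[of 1 "\<beta> k m" 1 "real (k (Suc m))"] Suc by (simp add: beta_Suc)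
qed (simp add: \<beta>_def)

text \<open>
  Generations multiply: the sets of children of distinct nodes are disjoint, so generation \<open>m + 1\<close>
  below \<open>v\<close> is \<open>k (d v + m + 1)\<close> times as large as generation \<open>m\<close>.
\<close>
lemma card_generation:
  assumes "v \<in> verts G"
  shows "finite ((child_rel ^^ m) `` {v}) \<and>
    real (card ((child_rel ^^ m) `` {v})) = \<beta> k (d v + m) / \<beta> k (d v)"
proof (induct m)
  case 0
  then show ?case using beta_pos[of "d v"] by simp
next
  case (Suc m)
  let ?L = "(child_rel ^^ m) `` {v}"
  have eq: "(child_rel ^^ Suc m) `` {v} = (\<Union>u\<in>?L. children G r u)"
    by (auto simp: child_rel_def)
  have verts: "u \<in> verts G" if "u \<in> ?L" for u
    using descendants_in_verts[OF assms, of u] that by (auto simp: descendants_def rtrancl_power)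
  have fin: "finite (children G r u)" if "u \<in> ?L" for u
    using finite_children verts that by blast
  have "card (\<Union>u\<in>?L. children G r u) = (\<Sum>u\<in>?L. card (children G r u))"
  proof (rule card_UN_disjoint)
    show "finite ?L" using Suc by simp
    show "\<forall>u\<in>?L. finite (children G r u)" using fin by blast
    show "\<forall>u\<in>?L. \<forall>w\<in>?L. u \<noteq> w \<longrightarrow> children G r u \<inter> children G r w = {}"
      using parent_unique by (auto simp: single_valued_def child_rel_def)
  qed
  also have "\<dots> = (\<Sum>u\<in>?L. k (d v + m + 1))"
    by (rule sum.cong) (auto simp: card_children verts relpow_child_rel_depth)
  finally have "card ((child_rel ^^ Suc m) `` {v}) = card ?L * k (d v + m + 1)"
    using eq by simp
  moreover have "finite ((child_rel ^^ Suc m) `` {v})" unfolding eq using Suc fin by blast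
  ultimately show ?case using Suc by (simp add: beta_Suc)
qed

lemma card_descendants:
  assumes v: "v \<in> verts G"
  shows "finite (level_set n \<inter> descendants v)"
    and "real (card (level_set n \<inter> descendants v)) = (\<Sum>j=d v..n. \<beta> k j) / \<beta> k (d v)"
proof -
  let ?L = "\<lambda>j. (child_rel ^^ (j - d v)) `` {v}"
  have eq: "level_set n \<inter> descendants v = (\<Union>j\<in>{d v..n}. ?L j)"
  proof
    show "level_set n \<inter> descendants v \<subseteq> (\<Union>j\<in>{d v..n}. ?L j)"
    proof
      fix x assume x: "x \<in> level_set n \<inter> descendants v"
      then obtain m where m: "(v, x) \<in> child_rel ^^ m"
        by (auto simp: descendants_def rtrancl_power)
      then have "d x = d v + m" by (rule relpow_child_rel_depth)
      then show "x \<in> (\<Union>j\<in>{d v..n}. ?L j)" using m x by (intro UN_I[of "d x"]) auto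
    qed
    show "(\<Union>j\<in>{d v..n}. ?L j) \<subseteq> level_set n \<inter> descendants v"
    proof
      fix x assume "x \<in> (\<Union>j\<in>{d v..n}. ?L j)"
      then obtain j where j: "j \<in> {d v..n}" "(v, x) \<in> child_rel ^^ (j - d v)" by auto
      have "x \<in> descendants v" using j(2) by (auto simp: descendants_def rtrancl_power)
      then show "x \<in> level_set n \<inter> descendants v"
        using relpow_child_rel_depth[OF j(2)] j(1) descendants_in_verts[OF v] by auto
    qed
  qed
  show "finite (level_set n \<inter> descendants v)" unfolding eq using card_generation[OF v] by auto
  have "card (\<Union>j\<in>{d v..n}. ?L j) = (\<Sum>j=d v..n. card (?L j))"
  proof (rule card_UN_disjoint)
    show "\<forall>i\<in>{d v..n}. \<forall>j\<in>{d v..n}. i \<noteq> j \<longrightarrow> ?L i \<inter> ?L j = {}"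
      by (auto dest!: relpow_child_rel_depth)
  qed (use card_generation[OF v] in auto)
  then have "real (card (level_set n \<inter> descendants v)) = (\<Sum>j=d v..n. real (card (?L j)))"
    using eq by simp
  also have "\<dots> = (\<Sum>j=d v..n. \<beta> k j / \<beta> k (d v))"
    by (rule sum.cong) (auto simp: card_generation[OF v])
  finally show "real (card (level_set n \<inter> descendants v)) = (\<Sum>j=d v..n. \<beta> k j) / \<beta> k (d v)"
    by (simp add: sum_divide_distrib)
qed

lemma card_level_set:
  "finite (level_set n)" "real (card (level_set n)) = (\<Sum>j\<le>n. \<beta> k j)"
proof -
  have eq: "level_set n \<inter> descendants r = level_set n" by (auto simp: descendants_root)
  show "finite (level_set n)" using card_descendants(1)[OF root, of n] eq by simp
  show "real (card (level_set n)) = (\<Sum>j\<le>n. \<beta> k j)"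
    using card_descendants(2)[OF root, of n] eq
    by (simp add: depth_root \<beta>_def atMost_atLeast0)
qed

lemma card_level_set_at_top: "filterlim (\<lambda>n. real (card (level_set n))) at_top sequentially"
proof (rule filterlim_at_top_mono[OF filterlim_real_sequentially])
  have "real n \<le> real (card (level_set n))" for n
    using sum_mono[of "{..n}" "\<lambda>_. 1" "\<beta> k"] beta_ge_1 by (simp add: card_level_set(2))
  then show "\<forall>\<^sub>F n in sequentially. real n \<le> real (card (level_set n))" by simp
qed

text \<open>
  Up to depth \<open>n\<close>, the number of descendants times \<open>\<beta> k (d v)\<close> differs from the number of all nodes
  by a constant \<open>C\<close>, the number of nodes above the generation of \<open>v\<close>.
\<close>
lemma descendants_fraction:
  assumes v: "v \<in> verts G"
  shows "(\<lambda>n. real (card (level_set n \<inter> descendants v)) / real (card (level_set n)))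
    \<longlonglongrightarrow> 1 / \<beta> k (d v)"
proof -
  let ?N = "\<lambda>n. real (card (level_set n))"
  define C where "C = (\<Sum>j<d v. \<beta> k j)"
  have lim: "(\<lambda>n. (1 - C / ?N n) / \<beta> k (d v)) \<longlonglongrightarrow> (1 - 0) / \<beta> k (d v)"
    using beta_pos[of "d v"]
    by (intro tendsto_intros real_tendsto_divide_at_top[OF _ card_level_set_at_top]) auto
  have ev: "\<forall>\<^sub>F n in sequentially. (1 - C / ?N n) / \<beta> k (d v)
      = real (card (level_set n \<inter> descendants v)) / ?N n"
    using eventually_ge_at_top[of "d v"]
      filterlim_at_top_dense[THEN iffD1, OF card_level_set_at_top, rule_format, of 0]
  proof eventually_elim
    case (elim n)
    have "{..n} = {..<d v} \<union> {d v..n}" using elim(1) by auto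
    then have "?N n = C + (\<Sum>j=d v..n. \<beta> k j)"
      unfolding card_level_set(2) C_def by (simp add: sum.union_disjoint ivl_disj_int)
    then show ?case using elim(2) beta_pos[of "d v"]
      by (simp add: card_descendants(2)[OF v] field_simps)
  qed
  show ?thesis using Lim_transform_eventually[OF lim ev] by simp
qed

end

section \<open>The asymptotic proportion\<close>

lemma real_choose_2: "2 * real (m choose 2) = real m * (real m - 1)"
  by (cases m) (simp_all add: choose_two real_of_nat_div field_simps)

lemma tendsto_pair_fraction:
  fixes A N :: "nat \<Rightarrow> real"
  assumes "(\<lambda>n. A n / N n) \<longlonglongrightarrow> q" and N: "filterlim N at_top sequentially"
  shows "(\<lambda>n. A n * (A n - 1) / (N n * (N n - 1))) \<longlonglongrightarrow> q\<^sup>2"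
proof -
  have inv: "(\<lambda>n. 1 / N n) \<longlonglongrightarrow> 0"
    by (rule real_tendsto_divide_at_top[OF tendsto_const N])
  have lim: "(\<lambda>n. (A n / N n) * (A n / N n - 1 / N n) / (1 - 1 / N n)) \<longlonglongrightarrow> q * (q - 0) / (1 - 0)"
    by (intro tendsto_intros assms inv) auto
  have "\<forall>\<^sub>F n in sequentially. (A n / N n) * (A n / N n - 1 / N n) / (1 - 1 / N n)
      = A n * (A n - 1) / (N n * (N n - 1))"
    using filterlim_at_top_dense[THEN iffD1, OF N, rule_format, of 1]
    by eventually_elim (simp add: field_simps)
  from Lim_transform_eventually[OF lim this] show ?thesis by (simp add: power2_eq_square)
qed

context level_regular_tree
begin

text \<open>
  All children of \<open>v\<close> have equally many descendants, so one child \<open>c\<close> represents all of them. The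
  proportion of the traffic that avoids \<open>v\<close> is a combination of two pair fractions, that of the
  non-descendants of \<open>v\<close> and \<open>K\<close> times that of the descendants of \<open>c\<close>.
\<close>
lemma traffic_proportion_tendsto:
  assumes v: "v \<in> verts G"
  shows "(\<lambda>n. traffic_proportion (truncation G r n) v)
    \<longlonglongrightarrow> 1 / \<beta> k (d v) * (2 - 1 / \<beta> k (d v) - 1 / \<beta> k (d v + 1))"
proof -
  define N where "N n = real (card (level_set n))" for n
  define S where "S n = real (card (level_set n \<inter> descendants v))" for n
  define K where "K = real (k (d v + 1))"
  have "children G r v \<noteq> {}"
    using card_children[OF v] k_pos[of "d v + 1"] by auto
  then obtain c where c: "c \<in> children G r v" by blast
  define s where "s n = real (card (level_set n \<inter> descendants c))" for n
  have cv: "w \<in> verts G" "d w = d v + 1" if "w \<in> children G r v" for w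
    using that by (auto simp: children_def)
  have N: "filterlim N at_top sequentially" unfolding N_def by (rule card_level_set_at_top)
  have S: "(\<lambda>n. S n / N n) \<longlonglongrightarrow> 1 / \<beta> k (d v)"
    unfolding S_def N_def by (rule descendants_fraction[OF v])
  have s: "(\<lambda>n. s n / N n) \<longlonglongrightarrow> 1 / \<beta> k (d v + 1)"
    unfolding s_def N_def using descendants_fraction[OF cv(1)[OF c]] cv(2)[OF c] by simp
  have large: "\<forall>\<^sub>F n in sequentially. N n > 1"
    using N by (simp add: filterlim_at_top_dense)
  have "(\<lambda>n. 1 - S n / N n) \<longlonglongrightarrow> 1 - 1 / \<beta> k (d v)" by (intro tendsto_intros S)
  moreover have "\<forall>\<^sub>F n in sequentially. 1 - S n / N n = (N n - S n) / N n"
    using large by eventually_elim (simp add: field_simps)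
  ultimately have NS: "(\<lambda>n. (N n - S n) / N n) \<longlonglongrightarrow> 1 - 1 / \<beta> k (d v)"
    by (rule Lim_transform_eventually)
  have lim: "(\<lambda>n. 1 - (N n - S n) * (N n - S n - 1) / (N n * (N n - 1))
        - K * (s n * (s n - 1) / (N n * (N n - 1))))
      \<longlonglongrightarrow> 1 - (1 - 1 / \<beta> k (d v))\<^sup>2 - K * (1 / \<beta> k (d v + 1))\<^sup>2"
    by (intro tendsto_intros tendsto_pair_fraction NS s N)
  have val: "1 - (1 - 1 / \<beta> k (d v))\<^sup>2 - K * (1 / \<beta> k (d v + 1))\<^sup>2
      = 1 / \<beta> k (d v) * (2 - 1 / \<beta> k (d v) - 1 / \<beta> k (d v + 1))"
    using beta_pos[of "d v"] k_pos[of "d v + 1"]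
    by (simp add: beta_Suc K_def field_simps power2_eq_square)
  have "\<forall>\<^sub>F n in sequentially. 1 - (N n - S n) * (N n - S n - 1) / (N n * (N n - 1))
        - K * (s n * (s n - 1) / (N n * (N n - 1)))
      = traffic_proportion (truncation G r n) v"
    using large eventually_ge_at_top[of "d v"]
  proof eventually_elim
    case (elim n)
    let ?t = "real (traffic (truncation G r n) v)"
    have "card (level_set n \<inter> descendants w) = card (level_set n \<inter> descendants c)"
      if "w \<in> children G r v" for w
      using card_descendants(2)[of w n] card_descendants(2)[of c n] cv[OF that] cv[OF c]
      by (simp flip: of_nat_eq_iff[where 'a = real])
    then have sum: "(\<Sum>w\<in>children G r v. card (level_set n \<inter> descendants w) choose 2)
        = k (d v + 1) * (card (level_set n \<inter> descendants c) choose 2)"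
      using card_children[OF v] by simp
    have outside: "real (card (level_set n - descendants v)) = N n - S n"
      using card_Diff_subset_Int[of "level_set n" "descendants v"] card_descendants(1)[OF v, of n]
        card_mono[OF card_level_set(1)[of n], of "level_set n \<inter> descendants v"]
      by (simp add: N_def S_def of_nat_diff)
    have "traffic (truncation G r n) v + (card (level_set n - descendants v) choose 2)
        + k (d v + 1) * (card (level_set n \<inter> descendants c) choose 2)
      = card (level_set n) choose 2"
      unfolding sum[symmetric]
      using elim v by (intro traffic_truncation card_level_set finite_children) auto
    from arg_cong[OF this, of real]
    have "?t + real (card (level_set n - descendants v) choose 2)
        + K * real (card (level_set n \<inter> descendants c) choose 2)
      = real (card (level_set n) choose 2)"
      unfolding K_def of_nat_add of_nat_mult .
    then have "2 * ?t + 2 * real (card (level_set n - descendants v) choose 2)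
        + K * (2 * real (card (level_set n \<inter> descendants c) choose 2))
      = 2 * real (card (level_set n) choose 2)"
      by (simp add: algebra_simps)
    then have "2 * ?t + (N n - S n) * (N n - S n - 1) + K * (s n * (s n - 1)) = N n * (N n - 1)"
      unfolding real_choose_2 outside by (simp add: N_def s_def)
    then have "2 * ?t = N n * (N n - 1) - (N n - S n) * (N n - S n - 1) - K * (s n * (s n - 1))"
      by simp
    moreover have "N n * (N n - 1) \<noteq> 0" using elim(1) by simp
    moreover have "traffic_proportion (truncation G r n) v = 2 * ?t / (N n * (N n - 1))"
      unfolding traffic_proportion_def verts_truncation N_def by (rule refl)
    moreover have "1 - a / W - K * (b / W) = (W - a - K * b) / W" if "W \<noteq> 0" for a b W
      using that by (simp add: diff_divide_distrib)
    ultimately show ?case by simp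
  qed
  from Lim_transform_eventually[OF lim this] show ?thesis by (simp only: val)
qed

end

text \<open>The lower limit in \<open>ap\<close> is a genuine limit.\<close>
theorem theorem3p1:
  fixes T :: "('a, 'b) pre_digraph" and r v :: 'a and k :: "nat \<Rightarrow> nat" and l :: nat
  assumes "k 0 = 1"
    and "\<And>i. k i > 0"
    and "undirected_tree T"
    and "r \<in> verts T"
    and "\<And>u. u \<in> verts T \<Longrightarrow> card (children T r u) = k (depth T r u + 1)"
    and "v \<in> verts T"
    and "depth T r v = l"
  shows "ap T r v = ereal (1 / \<beta> k l * (2 - 1 / \<beta> k l - 1 / \<beta> k (l + 1)))"
proof -
  interpret undirected_tree T by fact
  interpret level_regular_tree T r k by unfold_locales (use assms in auto)
  have "(\<lambda>n. ereal (traffic_proportion (truncation T r n) v))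
      \<longlonglongrightarrow> ereal (1 / \<beta> k l * (2 - 1 / \<beta> k l - 1 / \<beta> k (l + 1)))"
    using traffic_proportion_tendsto[OF assms(6)] assms(7) by simp
  then show ?thesis
    unfolding ap_def by (rule lim_imp_Liminf[OF sequentially_bot])
qed

end
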